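(* The following hold. (a) Let $n \equiv 0 \pmod 2$ and $n \ge 4$. If $F_1$ and $F_2$ are graphs on a common set of $n$ vertices, both isomorphic to the cycle $C_n$, then $\gamma_{\rm sd}(F_1,F_2) \le n/2$. Likewise, if $F_1$ and $F_2$ are graphs on a common set of $n$ vertices, both isomorphic to the path $P_n$, then $\gamma_{\rm sd}(F_1,F_2) \le n/2$. (b) Let $n \equiv 1 \pmod 2$ and $n \ge 5$. If $F_1$ and $F_2$ are graphs on a common set of $n$ vertices, both isomorphic to the cycle $C_n$, then $\gamma_{\rm sd}(F_1,F_2) \le (n+1)/2$.
   Context: All graphs are finite and simple; $C_n$ and $P_n$ denote the cycle and the path on $n$ vertices. Given graphs $F_1, F_2$ (called factors; not necessarily edge-disjoint) with common vertex set $V$, a set $S \subseteq V$ is a simultaneous dominating set if for each $i \in \{1,2\}$ every vertex not in $S$ is adjacent in $F_i$ to some vertex of $S$. The simultaneous domination number $\gamma_{\rm sd}(F_1,F_2)$ is the minimum cardinality of a simultaneous dominating set. *)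

theory Defs
  imports Complex_Main
begin

text \<open>A finite simple graph is given by a vertex set and a set of edges, each edge being a
  two-element set of vertices.\<close>

definition simple_graph :: "'a set \<Rightarrow> 'a set set \<Rightarrow> bool" where
  "simple_graph V E \<longleftrightarrow> finite V \<and> (\<forall>e\<in>E. e \<subseteq> V \<and> card e = 2)"

definition graph_iso :: "'a set \<Rightarrow> 'a set set \<Rightarrow> 'b set \<Rightarrow> 'b set set \<Rightarrow> bool" where
  "graph_iso V E W D \<longleftrightarrow>
     (\<exists>f. bij_betw f V W \<and> (\<forall>u\<in>V. \<forall>v\<in>V. {u, v} \<in> E \<longleftrightarrow> {f u, f v} \<in> D))"

text \<open>The cycle and the path on the vertex set \<open>{0..<n}\<close>; the former is a simple graph
  only for \<open>n \<ge> 3\<close>.\<close>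

definition cycle_edges :: "nat \<Rightarrow> nat set set" where
  "cycle_edges n = {{i, Suc i mod n} | i. i < n}"

definition path_edges :: "nat \<Rightarrow> nat set set" where
  "path_edges n = {{i, Suc i} | i. Suc i < n}"

definition is_cycle :: "nat \<Rightarrow> 'a set \<Rightarrow> 'a set set \<Rightarrow> bool" where
  "is_cycle n V E \<longleftrightarrow> graph_iso V E {0..<n} (cycle_edges n)"

definition is_path :: "nat \<Rightarrow> 'a set \<Rightarrow> 'a set set \<Rightarrow> bool" where
  "is_path n V E \<longleftrightarrow> graph_iso V E {0..<n} (path_edges n)"

definition dominating_set :: "'a set \<Rightarrow> 'a set set \<Rightarrow> 'a set \<Rightarrow> bool" where
  "dominating_set V E S \<longleftrightarrow> S \<subseteq> V \<and> (\<forall>v\<in>V - S. \<exists>s\<in>S. {v, s} \<in> E)"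

definition sim_dominating_set :: "'a set \<Rightarrow> 'a set set \<Rightarrow> 'a set set \<Rightarrow> 'a set \<Rightarrow> bool" where
  "sim_dominating_set V E1 E2 S \<longleftrightarrow> dominating_set V E1 S \<and> dominating_set V E2 S"

text \<open>For finite \<open>V\<close> the minimum is over a finite set, which is nonempty since \<open>V\<close> itself is a
  simultaneous dominating set.\<close>

definition sim_dom_number :: "'a set \<Rightarrow> 'a set set \<Rightarrow> 'a set set \<Rightarrow> nat" where
  "sim_dom_number V E1 E2 = Min (card ` {S. sim_dominating_set V E1 E2 S})"

end

theory Submission
  imports Defs
begin

text \<open>Two perfect matchings on a set \<open>W\<close> form a bipartite multigraph, and each of its colour
  classes dominates the other one in both matchings, so the smaller class is a simultaneous
  dominating set of \<open>W\<close> with at most \<open>card W / 2\<close> elements. Cycles and paths of even order have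
  perfect matchings. In the odd case any vertex \<open>v\<close> can be removed from both cycles: this leaves
  two paths of even order, and \<open>v\<close> is added to the dominating set.\<close>

text \<open>A matching is encoded by its partner function, a fixed-point-free involution of
  \<open>W\<close>, with no reference to a graph. The induction below may therefore rewire a
  matching along pairs that are not edges.\<close>

definition perfect_matching :: "'a set \<Rightarrow> ('a \<Rightarrow> 'a) \<Rightarrow> bool" where
  "perfect_matching W a \<longleftrightarrow> (\<forall>x\<in>W. a x \<in> W \<and> a x \<noteq> x \<and> a (a x) = x)"

text \<open>Induction on \<open>card W\<close> replaces tracing the alternating cycles: deleting a
  pair \<open>x\<close>, \<open>a x\<close> shortens one of them by two. Here \<open>a\<close> stays
  fixed, while \<open>b\<close> is generalised because it gets rewired.\<close>

lemma two_matchings_bipartite: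
  assumes "finite W" "perfect_matching W a" "perfect_matching W b"
  obtains S where "S \<subseteq> W" "\<And>x. x \<in> W \<Longrightarrow> a x \<in> S \<longleftrightarrow> x \<notin> S" "\<And>x. x \<in> W \<Longrightarrow> b x \<in> S \<longleftrightarrow> x \<notin> S"
proof -
  have "\<exists>S\<subseteq>W. \<forall>x\<in>W. (a x \<in> S \<longleftrightarrow> x \<notin> S) \<and> (b x \<in> S \<longleftrightarrow> x \<notin> S)"
    using assms
  proof (induction "card W" arbitrary: W b rule: less_induct)
    case less
    note a = less.prems(2)[unfolded perfect_matching_def, rule_format]
    note b = less.prems(3)[unfolded perfect_matching_def, rule_format]
    show ?case
    proof (cases "W = {}")
      case False
      then obtain x where x: "x \<in> W" by blast
      define y where "y = a x"
      define u where "u = b x"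
      define w where "w = b y"
      have y: "y \<in> W" "y \<noteq> x" and ax: "a x = y" using a[OF x] by (auto simp: y_def)
      have u: "u \<in> W" "u \<noteq> x" and bx: "b x = u" using b[OF x] by (auto simp: u_def)
      have w: "w \<in> W" "w \<noteq> y" and b_y: "b y = w" using b[OF y(1)] by (auto simp: w_def)
      have a_eq: "a z = x \<longleftrightarrow> z = y" "a z = y \<longleftrightarrow> z = x" if "z \<in> W" for z
        using a x y(1) ax that by metis+
      have b_eq: "b z = x \<longleftrightarrow> z = u" "b z = y \<longleftrightarrow> z = w" "b z = u \<longleftrightarrow> z = x" "b z = w \<longleftrightarrow> z = y"
        if "z \<in> W" for z
        using b x y(1) bx b_y that by metis+
      \<comment> \<open>The second fact isolates the case where \<open>x\<close> and
        \<open>y\<close> are partners in both matchings; then \<open>b'\<close> below equals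
        \<open>b\<close>, and the pair is simply deleted.\<close>
      have uw: "u \<noteq> w" "u = y \<longleftrightarrow> w = x" using b_eq[OF x] b_eq[OF y(1)] bx b_y y(2) by auto
      define W' where "W' = W - {x, y}"
      \<comment> \<open>Deleting the edge \<open>xy\<close> of \<open>a\<close> and joining the \<open>b\<close>-partners of its ends preserves
        the parity of the length of the alternating cycle through \<open>x\<close>.\<close>
      define b' where "b' = b(u := w, w := u)"
      have "card W' < card W"
        using x less.prems(1) by (auto simp: W'_def intro: psubset_card_mono)
      moreover have "perfect_matching W' a"
        using a a_eq by (auto simp: perfect_matching_def W'_def)
      moreover have "perfect_matching W' b'"
        unfolding perfect_matching_def
      proof
        fix z assume "z \<in> W'"
        then have "z \<in> W" "z \<noteq> x" "z \<noteq> y" by (auto simp: W'_def)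
        then show "b' z \<in> W' \<and> b' z \<noteq> z \<and> b' (b' z) = z"
          using b[of z] b_eq[of z] u w uw by (auto simp: b'_def W'_def)
      qed
      ultimately obtain S where S: "S \<subseteq> W'"
        "\<And>z. z \<in> W' \<Longrightarrow> a z \<in> S \<longleftrightarrow> z \<notin> S" "\<And>z. z \<in> W' \<Longrightarrow> b' z \<in> S \<longleftrightarrow> z \<notin> S"
        using less.hyps[of W' b'] less.prems(1) by (auto simp: W'_def)
      \<comment> \<open>\<open>x\<close> gets the colour opposite to that of \<open>u\<close>, and
        \<open>y\<close> the colour of \<open>u\<close>. For \<open>u\<close> distinct from
        \<open>y\<close>, the vertices \<open>u\<close> and \<open>w\<close> have opposite colours,
        so \<open>y\<close> differs from \<open>w\<close> too. If \<open>u = y\<close>, then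
        \<open>u\<close> is not in \<open>S\<close>, so \<open>x\<close> enters \<open>T\<close> and
        \<open>y\<close> does not.\<close>
      define T where "T = (if u \<in> S then insert y S else insert x S)"
      have xyS: "x \<notin> S" "y \<notin> S" using S(1) by (auto simp: W'_def)
      have T: "z \<in> T \<longleftrightarrow> (if z = x then u \<notin> S else if z = y then u \<in> S else z \<in> S)" for z
        using xyS y(2) by (auto simp: T_def)
      have wS: "w \<in> S \<longleftrightarrow> u \<notin> S" if "u \<noteq> y"
        using S(3)[of u] u w uw that by (auto simp: b'_def W'_def)
      have "a z \<in> T \<longleftrightarrow> z \<notin> T" if "z \<in> W" for z
        using that S(2)[of z] a_eq[of z] ax y(2) by (auto simp: T W'_def)
      moreover have "b z \<in> T \<longleftrightarrow> z \<notin> T" if z: "z \<in> W" for z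
      \<comment> \<open>Away from these four vertices \<open>b'\<close> agrees with
        \<open>b\<close>, so the colouring by \<open>S\<close> carries over.\<close>
      proof (cases "z \<in> {x, y, u, w}")
        case True
        moreover have "b u = x" "b w = y" using b_eq u w by auto
        ultimately show ?thesis using bx b_y wS xyS u w y(2) uw by (auto simp: T)
      next
        case False
        then show ?thesis using S(3)[of z] b_eq[OF z] z by (auto simp: T W'_def b'_def)
      qed
      moreover have "T \<subseteq> W" using S(1) x y(1) by (auto simp: T_def W'_def)
      ultimately show ?thesis by blast
    qed simp
  qed
  then show thesis using that by blast
qed

lemma two_matchings_half_dominating:
  assumes "finite W" "perfect_matching W a" "perfect_matching W b"
  obtains S where "S \<subseteq> W" "2 * card S \<le> card W" "\<And>x. x \<in> W - S \<Longrightarrow> a x \<in> S \<and> b x \<in> S"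
proof -
  obtain S where S: "S \<subseteq> W" "\<And>x. x \<in> W \<Longrightarrow> a x \<in> S \<longleftrightarrow> x \<notin> S" "\<And>x. x \<in> W \<Longrightarrow> b x \<in> S \<longleftrightarrow> x \<notin> S"
    using two_matchings_bipartite[OF assms] by blast
  have "card S + card (W - S) = card W"
    using S(1) assms(1) by (metis card_Diff_subset card_mono finite_subset le_add_diff_inverse)
  then consider "2 * card S \<le> card W" | "2 * card (W - S) \<le> card W" by linarith
  then show thesis
  proof cases
    case 1
    then show thesis using that[of S] S by auto
  next
    case 2
    then show thesis using that[of "W - S"] S assms(2,3) by (auto simp: perfect_matching_def)
  qed
qed

lemma sim_dom_number_le:
  assumes "finite V" "sim_dominating_set V E1 E2 S"
  shows "sim_dom_number V E1 E2 \<le> card S"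
proof -
  have "{S. sim_dominating_set V E1 E2 S} \<subseteq> Pow V"
    by (auto simp: sim_dominating_set_def dominating_set_def)
  then have "finite {S. sim_dominating_set V E1 E2 S}"
    using assms(1) by (meson finite_Pow_iff finite_subset)
  then show ?thesis using assms(2) by (auto simp: sim_dom_number_def intro: Min_le)
qed

text \<open>The smaller colour class dominates \<open>W\<close> in both graphs, and every vertex
  outside \<open>W\<close> is put into the dominating set. Doubling the bound avoids division on
  naturals.\<close>

lemma sim_dom_number_matchings:
  assumes "finite V" "W \<subseteq> V"
    and "perfect_matching W a" "\<And>x. x \<in> W \<Longrightarrow> {x, a x} \<in> E1"
    and "perfect_matching W b" "\<And>x. x \<in> W \<Longrightarrow> {x, b x} \<in> E2"
  shows "2 * sim_dom_number V E1 E2 \<le> card W + 2 * card (V - W)"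
proof -
  have "finite W" using assms(1,2) by (rule finite_subset[rotated])
  from two_matchings_half_dominating[OF this assms(3,5)] obtain S
    where S: "S \<subseteq> W" "2 * card S \<le> card W" "\<And>x. x \<in> W - S \<Longrightarrow> a x \<in> S \<and> b x \<in> S" by blast
  have "sim_dominating_set V E1 E2 (S \<union> (V - W))"
    unfolding sim_dominating_set_def dominating_set_def
    using S(1) S(3) assms(2,4,6) by blast
  then have "sim_dom_number V E1 E2 \<le> card (S \<union> (V - W))"
    by (rule sim_dom_number_le[OF assms(1)])
  also have "\<dots> \<le> card S + card (V - W)" by (rule card_Un_le)
  finally show ?thesis using S(2) by linarith
qed

text \<open>A Hamiltonian path, listed by \<open>g\<close>. Further edges may be present, so cycles
  and paths can be treated alike.\<close>

definition spanning_path :: "nat \<Rightarrow> 'a set \<Rightarrow> 'a set set \<Rightarrow> (nat \<Rightarrow> 'a) \<Rightarrow> bool" where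
  "spanning_path n V E g \<longleftrightarrow> bij_betw g {0..<n} V \<and> (\<forall>i. Suc i < n \<longrightarrow> {g i, g (Suc i)} \<in> E)"

lemma graph_iso_inverse:
  assumes "graph_iso V E W D"
  obtains g where "bij_betw g W V" "\<And>i j. i \<in> W \<Longrightarrow> j \<in> W \<Longrightarrow> {i, j} \<in> D \<Longrightarrow> {g i, g j} \<in> E"
proof -
  obtain f where f: "bij_betw f V W" "\<And>u v. u \<in> V \<Longrightarrow> v \<in> V \<Longrightarrow> {u, v} \<in> E \<longleftrightarrow> {f u, f v} \<in> D"
    using assms by (auto simp: graph_iso_def)
  let ?g = "inv_into V f"
  have g: "bij_betw ?g W V" using f(1) by (rule bij_betw_inv_into)
  show thesis
  proof (rule that[OF g])
    fix i j assume "i \<in> W" "j \<in> W" "{i, j} \<in> D"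
    then show "{?g i, ?g j} \<in> E"
      using f(2)[of "?g i" "?g j"] bij_betwE[OF g] bij_betw_inv_into_right[OF f(1)] by simp
  qed
qed

lemma is_path_spanning_path:
  assumes "is_path n V E"
  obtains g where "spanning_path n V E g"
proof -
  obtain g where "bij_betw g {0..<n} V"
    and "\<And>i j. i \<in> {0..<n} \<Longrightarrow> j \<in> {0..<n} \<Longrightarrow> {i, j} \<in> path_edges n \<Longrightarrow> {g i, g j} \<in> E"
    using graph_iso_inverse assms[unfolded is_path_def] by blast
  moreover have "{i, Suc i} \<in> path_edges n" if "Suc i < n" for i
    using that by (auto simp: path_edges_def)
  ultimately have "spanning_path n V E g" by (simp add: spanning_path_def)
  then show thesis by (rule that)
qed

lemma bij_betw_rotate:
  fixes n k :: nat
  shows "bij_betw (\<lambda>i. (i + k) mod n) {0..<n} {0..<n}"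
proof -
  have "inj_on (\<lambda>i. (i + k) mod n) {0..<n}"
  proof (rule inj_onI)
    fix i j assume ij: "i \<in> {0..<n}" "j \<in> {0..<n}" "(i + k) mod n = (j + k) mod n"
    \<comment> \<open>Completing the shift by \<open>k\<close> to one by \<open>n * k\<close> undoes
      it modulo \<open>n\<close> without subtraction.\<close>
    have "(i + k + (n - 1) * k) mod n = (j + k + (n - 1) * k) mod n"
      by (rule mod_add_cong[OF ij(3) refl])
    moreover have "l + k + (n - 1) * k = l + n * k" for l
      using ij(1) by (cases n) simp_all
    ultimately have "(i + n * k) mod n = (j + n * k) mod n" by (simp only:)
    then show "i = j" using ij(1,2) by simp
  qed
  moreover have "(\<lambda>i. (i + k) mod n) ` {0..<n} \<subseteq> {0..<n}" by auto
  ultimately show ?thesis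
    unfolding bij_betw_def using endo_inj_surj[OF finite_atLeastLessThan] by blast
qed

text \<open>The cycle is cut open right after \<open>v\<close>. The free choice of \<open>v\<close>
  lets two cycles be cut so that both paths end in the same vertex.\<close>

lemma is_cycle_spanning_path:
  assumes "is_cycle n V E" "v \<in> V"
  obtains g where "spanning_path n V E g" "g (n - 1) = v"
proof -
  obtain g where g: "bij_betw g {0..<n} V"
    and e: "\<And>i j. i \<in> {0..<n} \<Longrightarrow> j \<in> {0..<n} \<Longrightarrow> {i, j} \<in> cycle_edges n \<Longrightarrow> {g i, g j} \<in> E"
    using graph_iso_inverse assms(1)[unfolded is_cycle_def] by blast
  obtain c where c: "c < n" "g c = v"
    using bij_betw_imp_surj_on[OF g] assms(2) by auto
  \<comment> \<open>Since \<open>(n - 1) + Suc c = n + c\<close>, the last index is sent to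
    \<open>c\<close>, the position of \<open>v\<close>.\<close>
  define h where "h i = g ((i + Suc c) mod n)" for i
  have "bij_betw h {0..<n} V"
    using bij_betw_trans[OF bij_betw_rotate g, of "Suc c"] by (simp add: h_def[abs_def] o_def)
  moreover have "{h i, h (Suc i)} \<in> E" for i
  proof -
    let ?j = "(i + Suc c) mod n"
    have "?j < n" using c by simp
    then have "{?j, Suc ?j mod n} \<in> cycle_edges n" by (auto simp: cycle_edges_def)
    then have "{g ?j, g (Suc ?j mod n)} \<in> E" using c by (intro e) auto
    then show ?thesis by (simp add: h_def mod_Suc_eq)
  qed
  moreover have "h (n - 1) = v" using c by (simp add: h_def)
  ultimately show thesis using that[of h] by (simp add: spanning_path_def)
qed

text \<open>The positions \<open>2 * k\<close> and \<open>2 * k + 1\<close> along the path are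
  paired; \<open>m\<close> swaps them.\<close>

lemma spanning_path_matching:
  assumes "spanning_path n V E g" "even n"
  obtains a where "perfect_matching V a" "\<And>x. x \<in> V \<Longrightarrow> {x, a x} \<in> E"
proof -
  define m :: "nat \<Rightarrow> nat" where "m i = (if even i then Suc i else i - 1)" for i
  define f where "f = inv_into {0..<n} g"
  have g: "bij_betw g {0..<n} V" and e: "\<And>i. Suc i < n \<Longrightarrow> {g i, g (Suc i)} \<in> E"
    using assms(1) by (auto simp: spanning_path_def)
  have m: "m i < n" "m i \<noteq> i" "m (m i) = i" "{g i, g (m i)} \<in> E" if "i < n" for i
  proof -
    \<comment> \<open>For even \<open>n\<close> the last index is odd, so an even index always has
      its partner in range.\<close>
    have "Suc i < n" if "even i" using that \<open>i < n\<close> assms(2) by (metis Suc_lessI even_Suc)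
    then show "m i < n" "m i \<noteq> i" "m (m i) = i" "{g i, g (m i)} \<in> E"
      using that e[of i] e[of "i - 1"] by (auto simp: m_def insert_commute elim: oddE)
  qed
  have f: "f x < n" "g (f x) = x" if "x \<in> V" for x
    using that bij_betwE[OF bij_betw_inv_into[OF g]] bij_betw_inv_into_right[OF g]
    by (auto simp: f_def)
  have fg: "f (g i) = i" "g i \<in> V" if "i < n" for i
    using that bij_betw_inv_into_left[OF g] bij_betwE[OF g] by (auto simp: f_def)
  show thesis
  proof (rule that)
    show "perfect_matching V (\<lambda>x. g (m (f x)))"
      unfolding perfect_matching_def using m f fg by metis
    show "{x, g (m (f x))} \<in> E" if "x \<in> V" for x
      using m(4)[OF f(1)[OF that]] f(2)[OF that] by simp
  qed
qed

text \<open>Dropping the last vertex leaves an initial segment of indices, so the same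
  \<open>g\<close> still lists the path.\<close>

lemma spanning_path_delete_last:
  assumes "spanning_path n V E g" "n > 0"
  shows "spanning_path (n - 1) (V - {g (n - 1)}) E g"
proof -
  have "{0..<n - 1} = {0..<n} - {n - 1}" using assms(2) by auto
  moreover have "bij_betw g ({0..<n} - {n - 1}) (V - {g (n - 1)})"
    using assms bij_betw_DiffI[of g "{0..<n}" V "{n - 1}" "{g (n - 1)}"] bij_betwE[of g "{0..<n}" V]
    by (simp add: spanning_path_def)
  ultimately show ?thesis using assms(1) by (simp add: spanning_path_def)
qed

text \<open>Serves both parities: \<open>W = V\<close> with \<open>k = n\<close>, or
  \<open>W = V - {v}\<close> with \<open>k = n - 1\<close>.\<close>

lemma sim_dom_number_spanning_paths:
  assumes "finite V" "W \<subseteq> V" "even k" "spanning_path k W E1 g" "spanning_path k W E2 h"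
  shows "2 * sim_dom_number V E1 E2 \<le> card W + 2 * card (V - W)"
proof -
  obtain a where "perfect_matching W a" "\<And>x. x \<in> W \<Longrightarrow> {x, a x} \<in> E1"
    using spanning_path_matching assms(3,4) by blast
  moreover obtain b where "perfect_matching W b" "\<And>x. x \<in> W \<Longrightarrow> {x, b x} \<in> E2"
    using spanning_path_matching assms(3,5) by blast
  ultimately show ?thesis using sim_dom_number_matchings[OF assms(1,2)] by blast
qed

theorem theorem22:
  fixes n :: nat and V :: "'a set" and E1 E2 :: "'a set set"
  assumes "simple_graph V E1" and "simple_graph V E2" and "card V = n"
  shows "(n mod 2 = 0 \<and> n \<ge> 4 \<longrightarrow>
            (is_cycle n V E1 \<and> is_cycle n V E2 \<longrightarrow> real (sim_dom_number V E1 E2) \<le> real n / 2) \<and>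
            (is_path n V E1 \<and> is_path n V E2 \<longrightarrow> real (sim_dom_number V E1 E2) \<le> real n / 2)) \<and>
         (n mod 2 = 1 \<and> n \<ge> 5 \<longrightarrow>
            (is_cycle n V E1 \<and> is_cycle n V E2 \<longrightarrow>
               real (sim_dom_number V E1 E2) \<le> (real n + 1) / 2))"
proof -
  have V: "finite V" using assms(1) by (simp add: simple_graph_def)
  have even: "real (sim_dom_number V E1 E2) \<le> real n / 2"
    if "n mod 2 = 0" "spanning_path n V E1 g" "spanning_path n V E2 h" for g h
    using sim_dom_number_spanning_paths[OF V subset_refl _ that(2,3)] that(1) assms(3)
    by (simp add: even_iff_mod_2_eq_zero)
  have paths: "real (sim_dom_number V E1 E2) \<le> real n / 2"
    if asm: "n mod 2 = 0" "is_path n V E1" "is_path n V E2"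
  proof -
    obtain g where g: "spanning_path n V E1 g" using is_path_spanning_path[OF asm(2)] .
    obtain h where h: "spanning_path n V E2 h" using is_path_spanning_path[OF asm(3)] .
    show ?thesis using even[OF asm(1) g h] .
  qed
  have cycles: "real (sim_dom_number V E1 E2) \<le> real n / 2"
    if asm: "n mod 2 = 0" "n \<ge> 4" "is_cycle n V E1" "is_cycle n V E2"
  proof -
    obtain v where v: "v \<in> V" using asm(2) assms(3) by fastforce
    obtain g where g: "spanning_path n V E1 g" using is_cycle_spanning_path[OF asm(3) v] .
    obtain h where h: "spanning_path n V E2 h" using is_cycle_spanning_path[OF asm(4) v] .
    show ?thesis using even[OF asm(1) g h] .
  qed
  have odd_cycles: "real (sim_dom_number V E1 E2) \<le> (real n + 1) / 2"
    if asm: "n mod 2 = 1" "n \<ge> 5" "is_cycle n V E1" "is_cycle n V E2"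
  proof -
    \<comment> \<open>One \<open>v\<close> is fixed for both cycles, so that the two shortened paths
      span the same set.\<close>
    obtain v where v: "v \<in> V" using asm(2) assms(3) by fastforce
    obtain g where g: "spanning_path n V E1 g" "g (n - 1) = v"
      using is_cycle_spanning_path[OF asm(3) v] .
    obtain h where h: "spanning_path n V E2 h" "h (n - 1) = v"
      using is_cycle_spanning_path[OF asm(4) v] .
    have "spanning_path (n - 1) (V - {v}) E1 g" "spanning_path (n - 1) (V - {v}) E2 h"
      using spanning_path_delete_last[OF g(1)] spanning_path_delete_last[OF h(1)] g(2) h(2) asm(2)
      by auto
    moreover have "even (n - 1)" using asm(1) by presburger
    ultimately have "2 * sim_dom_number V E1 E2 \<le> card (V - {v}) + 2 * card (V - (V - {v}))"
      using sim_dom_number_spanning_paths[OF V Diff_subset] by blast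
    moreover have "V - (V - {v}) = {v}" using v by blast
    moreover have "card (V - {v}) = n - 1" using v V assms(3) by simp
    \<comment> \<open>In the doubled bound the paths contribute \<open>n - 1\<close> and the vertex
      \<open>v\<close> contributes 2.\<close>
    ultimately have "2 * sim_dom_number V E1 E2 \<le> n + 1" using asm(2) by simp
    then have "real (2 * sim_dom_number V E1 E2) \<le> real (n + 1)" by (simp only: of_nat_le_iff)
    then show ?thesis by simp
  qed
  show ?thesis
    by (intro conjI impI; elim conjE; rule paths cycles odd_cycles; assumption)
qed

end
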